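(* Let $\alpha,\beta,\gamma$ be complex numbers and let $x=(x_n)_{n\geq 1}$ be a sequence of complex numbers satisfying $x_{2n}=x_n$ and $x_{2n+1}=\alpha x_n+\beta x_{n+1}+\gamma$ for all $n\geq 1$. Then for all $n\geq 1$ we have \[x_n=x_{n^R}.\]
   Context: For an integer $n\geq 1$ with proper binary expansion $\varepsilon_\nu\cdots\varepsilon_0$ (that is, $n=\sum_{0\leq i\leq\nu}\varepsilon_i2^i$, $\varepsilon_i\in\{0,1\}$, $\varepsilon_\nu\neq 0$), the digit reversal of $n$ is $n^R=\sum_{0\leq i\leq \nu}\varepsilon_{\nu-i}2^i$. *)

theory Defs
  imports Complex_Main "HOL-Library.Discrete_Functions"
begin

(* For n >= 1, floor_log n is the index of the leading binary digit of n,
   and of_bool (bit n i) is the i-th binary digit; the value at n = 0 is irrelevant. *)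
definition digit_reversal :: "nat \<Rightarrow> nat" where
  "digit_reversal n = (\<Sum>i\<le>floor_log n. of_bool (bit n (floor_log n - i)) * 2 ^ i)"

lemma binary_sum_less:
  fixes e :: "nat \<Rightarrow> nat"
  assumes "\<And>i. i < m \<Longrightarrow> e i \<in> {0, 1}"
  shows "(\<Sum>i<m. e i * 2 ^ i) < 2 ^ m"
  using assms
proof (induction m)
  case (Suc m)
  have "(\<Sum>i<m. e i * 2 ^ i) < 2 ^ m" using Suc by simp
  moreover have "e m \<le> 1" using Suc.prems[of m] by auto
  then have "e m * 2 ^ m \<le> 2 ^ m" by simp
  ultimately show ?case unfolding sum.lessThan_Suc power_Suc by linarith
qed simp

lemma bit_binary_sum:
  fixes e :: "nat \<Rightarrow> nat"
  assumes "\<And>i. i < m \<Longrightarrow> e i \<in> {0, 1}" and "j < m"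
  shows "of_bool (bit (\<Sum>i<m. e i * 2 ^ i) j) = e j"
  using assms
proof (induction m arbitrary: e j)
  case (Suc m)
  have sum: "(\<Sum>i<Suc m. e i * 2 ^ i) = e 0 + 2 * (\<Sum>i<m. e (Suc i) * 2 ^ i)"
    by (simp only: sum.lessThan_Suc_shift) (simp add: sum_distrib_left mult.left_commute)
  have e0: "e 0 = 0 \<or> e 0 = 1" using Suc.prems(1)[of 0] by simp
  show ?case
  proof (cases j)
    case 0
    then show ?thesis using e0 unfolding sum by (auto simp: bit_0)
  next
    case (Suc k)
    have "of_bool (bit (\<Sum>i<m. e (Suc i) * 2 ^ i) k) = e (Suc k)"
      using Suc.prems Suc by (intro Suc.IH) auto
    moreover have "(e 0 + 2 * (\<Sum>i<m. e (Suc i) * 2 ^ i)) div 2 = (\<Sum>i<m. e (Suc i) * 2 ^ i)"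
      using e0 by auto
    ultimately show ?thesis unfolding sum Suc bit_Suc by simp
  qed
qed simp

lemma digit_reversal_expansion:
  fixes e :: "nat \<Rightarrow> nat"
  assumes n: "n = (\<Sum>i\<le>v. e i * 2 ^ i)"
    and digits: "\<And>i. i \<le> v \<Longrightarrow> e i \<in> {0, 1}" and leading: "e v \<noteq> 0"
  shows "digit_reversal n = (\<Sum>i\<le>v. e (v - i) * 2 ^ i)"
proof -
  have n': "n = (\<Sum>i<Suc v. e i * 2 ^ i)" using n by (simp add: lessThan_Suc_atMost)
  have "e v = 1" using digits[of v] leading by auto
  then have lower: "2 ^ v \<le> n" using n' by simp
  have upper: "n < 2 ^ Suc v"
    unfolding n' by (rule binary_sum_less) (use digits in auto)
  have v: "floor_log n = v"
    using lower upper by (intro floor_log_eqI) auto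
  have bits: "of_bool (bit n j) = e j" if "j \<le> v" for j
    unfolding n' by (rule bit_binary_sum) (use digits that in auto)
  show ?thesis
    unfolding digit_reversal_def v by (intro sum.cong refl) (simp add: bits)
qed

end

theory Submission
  imports Defs
begin

text \<open>
  Trailing zeros of \<open>n\<close> change neither \<open>x n\<close> nor the reversal, so it suffices to treat words
  \<open>1 u 1\<close>. The vectors \<open>V m = (x m, x (m + 1), 1)\<close> satisfy \<open>V (2 m + d) = A\<^sub>d (V m)\<close> for fixed
  matrices \<open>A\<^sub>0, A\<^sub>1\<close>, and \<open>x\<close> at \<open>1 u 1\<close> is \<open>\<ell> A\<^sub>u (V 1)\<close> with \<open>\<ell> = (\<alpha>, \<beta>, \<gamma>)\<close>. Generically some
  symmetric matrix \<open>S\<close> makes both \<open>A\<^sub>d S\<close> symmetric and sends \<open>\<ell>\<close> to a multiple of \<open>V 1\<close>; it converts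
  the row \<open>\<ell> A\<^sub>u\<close> into the column \<open>V\<close> at \<open>1 u\<^sup>R\<close>. Writing the row as \<open>(\<alpha> a, \<beta> b, \<gamma> c)\<close> turns this
  correspondence into identities without denominators, valid for all parameters.
\<close>

text \<open>Digit lists are little-endian: the head is the least significant digit.\<close>

definition push_digit :: "bool \<Rightarrow> nat \<Rightarrow> nat" where
  "push_digit d m = of_bool d + 2 * m"

lemma horner_sum_push_digit:
  "horner_sum of_bool 2 ds = foldr push_digit ds 0"
  by (simp add: horner_sum_foldr push_digit_def[abs_def] comp_def)

lemma ex_binary_digits:
  assumes "n \<ge> 1"
  shows "\<exists>ds. ds \<noteq> [] \<and> last ds \<and> n = foldr push_digit ds 0"
  using assms
proof (induction n rule: less_induct)
  case (less n)
  show ?case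
  proof (cases "n = 1")
    case True
    then show ?thesis by (intro exI[of _ "[True]"]) (simp add: push_digit_def)
  next
    case False
    with less.prems have "n div 2 < n" "n div 2 \<ge> 1" by auto
    with less.IH obtain ds where ds: "ds \<noteq> []" "last ds" "n div 2 = foldr push_digit ds 0"
      by blast
    have "n = push_digit (odd n) (n div 2)"
      by (simp add: push_digit_def)
    then have "n = foldr push_digit (odd n # ds) 0"
      using ds(3) by simp
    then show ?thesis using ds(1,2) by (intro exI[of _ "odd n # ds"]) auto
  qed
qed

lemma foldr_push_digit_pos:
  "ds \<noteq> [] \<Longrightarrow> last ds \<Longrightarrow> foldr push_digit ds 0 \<ge> 1"
  by (induction ds) (auto simp: push_digit_def split: if_splits)

text \<open>\<open>last ds\<close> makes the leading digit 1, so \<open>ds\<close> is the proper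
  expansion. \<open>rev ds\<close> may have leading zeros, which are harmless.\<close>

lemma digit_reversal_foldr_push_digit:
  assumes "ds \<noteq> []" "last ds"
  shows "digit_reversal (foldr push_digit ds 0) = foldr push_digit (rev ds) 0"
proof -
  define v where "v = length ds - 1"
  have len: "length ds = Suc v" using assms(1) by (simp add: v_def)
  have sum: "foldr push_digit es 0 = (\<Sum>i\<le>v. of_bool (es ! i) * 2 ^ i)"
    if "length es = Suc v" for es
    using that by (simp add: horner_sum_push_digit[symmetric] horner_sum_eq_sum
        atLeast0LessThan lessThan_Suc_atMost)
  have "digit_reversal (foldr push_digit ds 0) = (\<Sum>i\<le>v. of_bool (ds ! (v - i)) * 2 ^ i)"
    by (rule digit_reversal_expansion[OF sum[OF len]])
      (use assms in \<open>auto simp: v_def last_conv_nth\<close>)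
  also have "\<dots> = (\<Sum>i\<le>v. of_bool (rev ds ! i) * 2 ^ i)"
    by (intro sum.cong refl) (simp add: rev_nth len)
  also have "\<dots> = foldr push_digit (rev ds) 0"
    by (simp add: sum len)
  finally show ?thesis .
qed

context
  fixes \<alpha> \<beta> \<gamma> :: "'a :: comm_ring_1" and x :: "nat \<Rightarrow> 'a"
  assumes even: "\<And>n. n \<ge> 1 \<Longrightarrow> x (2 * n) = x n"
    and odd: "\<And>n. n \<ge> 1 \<Longrightarrow> x (2 * n + 1) = \<alpha> * x n + \<beta> * x (n + 1) + \<gamma>"
begin

text \<open>In the recurrence the terms in \<alpha> * \<beta> * \<open>x 1\<close> cancel, and
  \<gamma> times the last assumption collapses the rest to \<gamma> * c.\<close>

lemma x_odd_from_row:
  assumes "n \<ge> 1"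
    and "x n = \<beta> * b * x 1 + \<gamma> * c + ((1 - \<beta>) * x 1 - \<gamma>) * a"
    and "x (n + 1) = \<alpha> * a * x 1 + \<gamma> * c + ((1 - \<alpha>) * x 1 - \<gamma>) * b"
    and "\<alpha> * a + \<beta> * b - 1 = (\<alpha> + \<beta> - 1) * c"
  shows "x (2 * n + 1) = \<alpha> * a * x 1 + \<beta> * b * x 1 + \<gamma> * c"
  unfolding odd[OF assms(1)] assms(2,3)
  using arg_cong[OF assms(4), of "\<lambda>t. \<gamma> * t"] by (simp add: algebra_simps)

text \<open>Up to cleared denominators, \<open>S\<close> has off-diagonal entries
  \<open>x 1\<close>, 1, 1 and diagonal ((1 - \<beta>) \<open>x 1\<close> - \<gamma>)/\<alpha>, ((1
  - \<alpha>) \<open>x 1\<close> - \<gamma>)/\<beta>, (1 - \<alpha> - \<beta>)/\<gamma>; the last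
  identity is the constant coordinate of the column. A digit appended to \<open>u\<close> acts first
  on \<open>m\<close> in \<open>F\<close> and becomes the lowest digit of \<open>N\<close>.\<close>

lemma row_column_correspondence:
  defines "F u \<equiv> foldr push_digit (True # u)"
    and "N u \<equiv> foldr push_digit (rev u @ [True]) 0"
  shows "\<exists>a b c.
    (\<forall>m\<ge>1. x (F u m) = \<alpha> * a * x m + \<beta> * b * x (m + 1) + \<gamma> * c) \<and>
    x (N u) = \<beta> * b * x 1 + \<gamma> * c + ((1 - \<beta>) * x 1 - \<gamma>) * a \<and>
    x (N u + 1) = \<alpha> * a * x 1 + \<gamma> * c + ((1 - \<alpha>) * x 1 - \<gamma>) * b \<and>
    \<alpha> * a + \<beta> * b - 1 = (\<alpha> + \<beta> - 1) * c"
proof (induction u rule: rev_induct)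
  case Nil
  have "x (Suc (Suc 0)) = x (Suc 0)" using even[of 1] by (simp add: numeral_2_eq_2)
  then show ?case
    \<comment> \<open>The empty word leaves the row (\<alpha>, \<beta>, \<gamma>), so a = b = c =
      1.\<close>
    using odd by (intro exI[of _ 1]) (simp add: F_def N_def push_digit_def algebra_simps)
next
  case (snoc d u)
  then obtain a b c where
    row: "\<And>m. m \<ge> 1 \<Longrightarrow> x (F u m) = \<alpha> * a * x m + \<beta> * b * x (m + 1) + \<gamma> * c"
    and y: "x (N u) = \<beta> * b * x 1 + \<gamma> * c + ((1 - \<beta>) * x 1 - \<gamma>) * a"
    and z: "x (N u + 1) = \<alpha> * a * x 1 + \<gamma> * c + ((1 - \<alpha>) * x 1 - \<gamma>) * b"
    and sum: "\<alpha> * a + \<beta> * b - 1 = (\<alpha> + \<beta> - 1) * c"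
    by blast
  have N_pos: "N u \<ge> 1" unfolding N_def by (rule foldr_push_digit_pos) auto
  have snoc_simps: "N (u @ [d]) = push_digit d (N u)" "F (u @ [d]) m = F u (push_digit d m)" for m
    by (simp_all add: N_def F_def)
  have x_succ: "x (2 * n + 2) = x (n + 1)" for n using even[of "n + 1"] by simp
  \<comment> \<open>This value is the first coordinate of the new column for digit 1 and the second
    for digit 0.\<close>
  note x_N = x_odd_from_row[OF N_pos y z sum]
  show ?case
  proof (cases d)
    case True
    \<comment> \<open>Expanding the row at the extended argument leaves the factors \<alpha>,
      \<beta>, \<gamma> visible, so the new a, b, c are read off without division; likewise for
      digit 0.\<close>
    have row': "x (F u (2 * m + 1))
        = \<alpha> * (\<alpha> * a) * x m + \<beta> * (b + \<alpha> * a) * x (m + 1) + \<gamma> * (c + \<alpha> * a)" if "m \<ge> 1" for m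
      using row[of "2 * m + 1"] odd[OF that] x_succ[of m]
      by (simp add: algebra_simps)
    have y': "x (2 * N u + 1) = \<beta> * (b + \<alpha> * a) * x 1 + \<gamma> * (c + \<alpha> * a)
        + ((1 - \<beta>) * x 1 - \<gamma>) * (\<alpha> * a)"
      unfolding x_N by (simp add: algebra_simps)
    have z': "x (2 * N u + 2) = \<alpha> * (\<alpha> * a) * x 1 + \<gamma> * (c + \<alpha> * a)
        + ((1 - \<alpha>) * x 1 - \<gamma>) * (b + \<alpha> * a)"
      unfolding x_succ z by (simp add: algebra_simps)
    have sum': "\<alpha> * (\<alpha> * a) + \<beta> * (b + \<alpha> * a) - 1 = (\<alpha> + \<beta> - 1) * (c + \<alpha> * a)"
      using sum by (simp add: algebra_simps)
    show ?thesis
      unfolding snoc_simps using row' y' z' sum' True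
      by - (rule exI[of _ "\<alpha> * a"], rule exI[of _ "b + \<alpha> * a"], rule exI[of _ "c + \<alpha> * a"],
        simp add: push_digit_def)
  next
    case False
    have row': "x (F u (2 * m))
        = \<alpha> * (a + \<beta> * b) * x m + \<beta> * (\<beta> * b) * x (m + 1) + \<gamma> * (c + \<beta> * b)" if "m \<ge> 1" for m
      using row[of "2 * m"] odd[OF that] even[OF that] that
      by (simp add: algebra_simps)
    have y': "x (2 * N u) = \<beta> * (\<beta> * b) * x 1 + \<gamma> * (c + \<beta> * b)
        + ((1 - \<beta>) * x 1 - \<gamma>) * (a + \<beta> * b)"
      unfolding even[OF N_pos] y by (simp add: algebra_simps)
    have z': "x (2 * N u + 1) = \<alpha> * (a + \<beta> * b) * x 1 + \<gamma> * (c + \<beta> * b)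
        + ((1 - \<alpha>) * x 1 - \<gamma>) * (\<beta> * b)"
      unfolding x_N by (simp add: algebra_simps)
    have sum': "\<alpha> * (a + \<beta> * b) + \<beta> * (\<beta> * b) - 1 = (\<alpha> + \<beta> - 1) * (c + \<beta> * b)"
      using sum by (simp add: algebra_simps)
    show ?thesis
      unfolding snoc_simps using row' y' z' sum' False
      by - (rule exI[of _ "a + \<beta> * b"], rule exI[of _ "\<beta> * b"], rule exI[of _ "c + \<beta> * b"],
        simp add: push_digit_def)
  qed
qed

text \<open>The row for \<open>u\<close> at m = 1, where \<open>x 2\<close> = \<open>x 1\<close>,
  equals the value obtained by appending a digit 1 to the column index \<open>N\<close>.\<close>

lemma x_reverse_middle:
  "x (foldr push_digit (True # u @ [True]) 0) = x (foldr push_digit (True # rev u @ [True]) 0)"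
proof -
  define N where "N = foldr push_digit (rev u @ [True]) 0"
  have N_pos: "N \<ge> 1" unfolding N_def by (rule foldr_push_digit_pos) auto
  from row_column_correspondence[of u] obtain a b c where
    row: "\<And>m. m \<ge> 1 \<Longrightarrow>
      x (foldr push_digit (True # u) m) = \<alpha> * a * x m + \<beta> * b * x (m + 1) + \<gamma> * c"
    and y: "x N = \<beta> * b * x 1 + \<gamma> * c + ((1 - \<beta>) * x 1 - \<gamma>) * a"
    and z: "x (N + 1) = \<alpha> * a * x 1 + \<gamma> * c + ((1 - \<alpha>) * x 1 - \<gamma>) * b"
    and sum: "\<alpha> * a + \<beta> * b - 1 = (\<alpha> + \<beta> - 1) * c"
    unfolding N_def by blast
  have "x 2 = x 1" using even[of 1] by simp
  then have "x (foldr push_digit (True # u) 1) = x (2 * N + 1)"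
    using row[of 1] x_odd_from_row[OF N_pos y z sum] by (simp add: numeral_2_eq_2)
  then show ?thesis by (simp add: N_def push_digit_def)
qed

text \<open>Low zeros are stripped by induction, as reversal makes them leading zeros; what remains
  is a single 1 or a word with 1 at both ends.\<close>

lemma x_foldr_push_digit_rev:
  assumes "ds \<noteq> []" "last ds"
  shows "x (foldr push_digit ds 0) = x (foldr push_digit (rev ds) 0)"
  using assms
proof (induction ds)
  case (Cons d ds)
  show ?case
  proof (cases "ds = []")
    case False
    with Cons.prems have last: "last ds" by simp
    show ?thesis
    proof (cases d)
      case True
      obtain u where "ds = u @ [True]"
        using False last by (metis append_butlast_last_id)
      then show ?thesis using x_reverse_middle[of u] True by simp
    next
      case d: False
      have "foldr push_digit ds 0 \<ge> 1"
        using False last by (rule foldr_push_digit_pos)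
      then have "x (foldr push_digit (d # ds) 0) = x (foldr push_digit ds 0)"
        using even d by (simp add: push_digit_def)
      then show ?thesis using Cons.IH[OF False last] d
        by (simp add: push_digit_def[of False 0])
    qed
  qed simp
qed simp

end

theorem theorem2p4:
  fixes \<alpha> \<beta> \<gamma> :: complex and x :: "nat \<Rightarrow> complex"
  assumes "\<And>n. n \<ge> 1 \<Longrightarrow> x (2 * n) = x n"
    and "\<And>n. n \<ge> 1 \<Longrightarrow> x (2 * n + 1) = \<alpha> * x n + \<beta> * x (n + 1) + \<gamma>"
  shows "\<forall>n\<ge>1. x n = x (digit_reversal n)"
proof (intro allI impI)
  fix n :: nat
  assume "n \<ge> 1"
  then obtain ds where ds: "ds \<noteq> []" "last ds" and n: "n = foldr push_digit ds 0"
    using ex_binary_digits by blast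
  show "x n = x (digit_reversal n)"
    unfolding n digit_reversal_foldr_push_digit[OF ds]
    using assms ds by (rule x_foldr_push_digit_rev)
qed

end
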